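(* Let $\mathcal{H}$ be a separable Hilbert space, let $K\in B(\mathcal{H})$ be an operator with closed range, and let $W=\{(W_i,\omega_i)\}_{i\in I}$ be a fusion frame for $R(K^* )$. Then $\{(KW_i,\omega_i)\}_{i\in I}$ is a $K$-fusion frame for $\mathcal{H}$.
   Context: $I$ is a countable index set; $R(T)$ is the range of $T$; $\pi_V$ is the orthogonal projection of $\mathcal{H}$ onto a closed subspace $V$. A fusion frame for a closed subspace $M$ of $\mathcal{H}$ is a family $\{(W_i,\omega_i)\}_{i\in I}$ of closed subspaces $W_i$ of $M$ with weights $\omega_i>0$ such that, for some $0<A\le B<\infty$, $A\|f\|^2\le\sum_i\omega_i^2\|\pi_{W_i}f\|^2\le B\|f\|^2$ for all $f\in M$. A family $\{(V_i,\omega_i)\}_{i\in I}$ of closed subspaces of $\mathcal{H}$ with weights $\omega_i>0$ is a $K$-fusion frame for $\mathcal{H}$ if there are $0<A,B<\infty$ with $A\|K^*f\|^2\le\sum_i\omega_i^2\|\pi_{V_i}f\|^2\le B\|f\|^2$ for all $f\in\mathcal{H}$. *)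

theory Defs
  imports "HOL-Analysis.Analysis"
begin

(* The library has Hilbert spaces over the reals only (real_inner). To cover real and complex
   Hilbert spaces by one statement, the scalars range over the following class. Its only models
   are the reals with the identity and the complex numbers with the usual conjugation: the last
   axiom for x and 1 + x makes x + conjugate x real, so every x is a root of a real quadratic. *)

class real_or_complex = real_normed_field +
  fixes conjugate :: "'a \<Rightarrow> 'a"
  assumes conjugate_add: "conjugate (x + y) = conjugate x + conjugate y"
    and conjugate_mult: "conjugate (x * y) = conjugate x * conjugate y"
    and conjugate_conjugate: "conjugate (conjugate x) = x"
    and conjugate_scaleR: "conjugate (r *\<^sub>R x) = r *\<^sub>R conjugate x"
    and mult_conjugate: "x * conjugate x = (norm x)\<^sup>2 *\<^sub>R 1"

instantiation real :: real_or_complex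
begin
definition conjugate_real :: "real \<Rightarrow> real" where "conjugate_real x = x"
instance by standard (simp_all add: conjugate_real_def power2_eq_square)
end

instantiation complex :: real_or_complex
begin
definition conjugate_complex :: "complex \<Rightarrow> complex" where "conjugate_complex = cnj"
instance by standard (simp_all add: conjugate_complex_def scaleR_conv_of_real complex_norm_square del: of_real_power)
end

(* The inner product is linear in its first argument. Completeness is part of the class banach;
   the last axiom ties the norm, and with it the topology, of the type to the inner product. *)

locale hilbert_space = vector_space smul
  for smul :: "'k::real_or_complex \<Rightarrow> 'h::banach \<Rightarrow> 'h" +
  fixes ip :: "'h \<Rightarrow> 'h \<Rightarrow> 'k"
  assumes smul_of_real: "smul (of_real r) x = r *\<^sub>R x"
    and ip_add_left: "ip (x + y) z = ip x z + ip y z"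
    and ip_smul_left: "ip (smul c x) y = c * ip x y"
    and ip_conjugate: "ip y x = conjugate (ip x y)"
    and ip_self: "ip x x = of_real ((norm x)\<^sup>2)"

lemma hilbert_space_real:
  "hilbert_space (*\<^sub>R) (inner :: 'h::{real_inner, banach} \<Rightarrow> 'h \<Rightarrow> real)"
  by unfold_locales
    (auto simp: algebra_simps inner_commute power2_norm_eq_inner conjugate_real_def)

lemma hilbert_space_complex: "hilbert_space (*) (\<lambda>x y :: complex. x * cnj y)"
  by unfold_locales
    (auto simp: algebra_simps scaleR_conv_of_real conjugate_complex_def complex_norm_square
      simp del: of_real_power)

definition bounded_operator :: "('k::real_or_complex \<Rightarrow> 'h::banach \<Rightarrow> 'h) \<Rightarrow> ('h \<Rightarrow> 'h) \<Rightarrow> bool" where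
  "bounded_operator smul T \<longleftrightarrow>
     Vector_Spaces.linear smul smul T \<and> (\<exists>C. \<forall>x. norm (T x) \<le> C * norm x)"

definition hilbert_adjoint :: "('h::banach \<Rightarrow> 'h \<Rightarrow> 'k::real_or_complex) \<Rightarrow> ('h \<Rightarrow> 'h) \<Rightarrow> 'h \<Rightarrow> 'h" where
  "hilbert_adjoint ip T = (THE S. \<forall>x y. ip (T x) y = ip x (S y))"

(* module.subspace is used with the given scalar multiplication; the library's plain subspace
   would mean real-linear subspaces. *)

definition closed_subspace :: "('k::real_or_complex \<Rightarrow> 'h::banach \<Rightarrow> 'h) \<Rightarrow> 'h set \<Rightarrow> bool" where
  "closed_subspace smul V \<longleftrightarrow> module.subspace smul V \<and> closed V"

definition orth_proj :: "('h::banach \<Rightarrow> 'h \<Rightarrow> 'k::real_or_complex) \<Rightarrow> 'h set \<Rightarrow> 'h \<Rightarrow> 'h" where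
  "orth_proj ip V x = (THE p. p \<in> V \<and> (\<forall>v\<in>V. ip (x - p) v = 0))"

(* An infsum of reals is 0 when it diverges, so convergence is required explicitly. *)

definition fusion_frame_for ::
  "('k::real_or_complex \<Rightarrow> 'h::banach \<Rightarrow> 'h) \<Rightarrow> ('h \<Rightarrow> 'h \<Rightarrow> 'k) \<Rightarrow> 'h set \<Rightarrow>
   'i set \<Rightarrow> ('i \<Rightarrow> 'h set) \<Rightarrow> ('i \<Rightarrow> real) \<Rightarrow> bool" where
  "fusion_frame_for smul ip M I W \<omega> \<longleftrightarrow>
     (\<forall>i\<in>I. closed_subspace smul (W i) \<and> W i \<subseteq> M \<and> 0 < \<omega> i) \<and>
     (\<exists>A B. 0 < A \<and> A \<le> B \<and>
        (\<forall>f\<in>M. (\<lambda>i. (\<omega> i)\<^sup>2 * (norm (orth_proj ip (W i) f))\<^sup>2) summable_on I \<and>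
           A * (norm f)\<^sup>2 \<le> (\<Sum>\<^sub>\<infinity>i\<in>I. (\<omega> i)\<^sup>2 * (norm (orth_proj ip (W i) f))\<^sup>2) \<and>
           (\<Sum>\<^sub>\<infinity>i\<in>I. (\<omega> i)\<^sup>2 * (norm (orth_proj ip (W i) f))\<^sup>2) \<le> B * (norm f)\<^sup>2))"

definition K_fusion_frame ::
  "('k::real_or_complex \<Rightarrow> 'h::banach \<Rightarrow> 'h) \<Rightarrow> ('h \<Rightarrow> 'h \<Rightarrow> 'k) \<Rightarrow> ('h \<Rightarrow> 'h) \<Rightarrow>
   'i set \<Rightarrow> ('i \<Rightarrow> 'h set) \<Rightarrow> ('i \<Rightarrow> real) \<Rightarrow> bool" where
  "K_fusion_frame smul ip K I V \<omega> \<longleftrightarrow>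
     (\<forall>i\<in>I. closed_subspace smul (V i) \<and> 0 < \<omega> i) \<and>
     (\<exists>A B. 0 < A \<and> 0 < B \<and>
        (\<forall>f. (\<lambda>i. (\<omega> i)\<^sup>2 * (norm (orth_proj ip (V i) f))\<^sup>2) summable_on I \<and>
           A * (norm (hilbert_adjoint ip K f))\<^sup>2
             \<le> (\<Sum>\<^sub>\<infinity>i\<in>I. (\<omega> i)\<^sup>2 * (norm (orth_proj ip (V i) f))\<^sup>2) \<and>
           (\<Sum>\<^sub>\<infinity>i\<in>I. (\<omega> i)\<^sup>2 * (norm (orth_proj ip (V i) f))\<^sup>2) \<le> B * (norm f)\<^sup>2))"

end

theory Submission
  imports Defs
begin

text \<open>
  Write \<open>K*\<close> for the adjoint and \<open>\<pi>\<close> for orthogonal projections. The proof compares the two frame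
  sums term by term: if \<open>norm (K x) \<le> C * norm x\<close> for all \<open>x\<close>, and
  \<open>c * norm w \<le> norm (K w)\<close> for all \<open>w\<close> in the range of \<open>K*\<close>, then for every closed subspace
  \<open>W\<close> of that range
  \<open>c * norm (\<pi>\<^bsub>KW\<^esub> f) \<le> norm (\<pi>\<^bsub>W\<^esub> (K* f)) \<le> C * norm (\<pi>\<^bsub>KW\<^esub> f)\<close>.
  Both inequalities rest on one identity, valid for \<open>w\<close> in \<open>W\<close>: the inner product of
  \<open>\<pi>\<^bsub>W\<^esub> (K* f)\<close> with \<open>w\<close> is that of \<open>K* f\<close> with \<open>w\<close>, hence that of \<open>f\<close> with
  \<open>K w\<close>, hence that of \<open>\<pi>\<^bsub>KW\<^esub> f\<close> with \<open>K w\<close>. The fusion frame inequalities at the vector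
  \<open>K* f\<close>, with bounds \<open>A\<close> and \<open>B\<close>, then become the \<open>K\<close>-fusion frame inequalities at \<open>f\<close>, with
  bounds \<open>A / C\<^sup>2\<close> and \<open>B * C\<^sup>2 / c\<^sup>2\<close>; the factor \<open>C\<^sup>2\<close> in the latter
  comes from \<open>norm (K* f) \<le> C * norm f\<close>.

  The constant \<open>c\<close> is where the closed range enters (\<open>bounded_below_on_range_adjoint\<close>). Uniform
  boundedness, derived from the Baire category theorem (\<open>weakly_bounded_imp_bounded\<close>), shows that
  \<open>K*\<close> is bounded below on the range of \<open>K\<close>, and duality carries this over to \<open>K\<close> on
  the range of \<open>K*\<close>. The same constant makes the images \<open>K ` W\<close> closed.

  The Hilbert space theory underneath is developed for the abstract inner product: nearest points give
  orthogonal projections, projections give the Riesz representation, and that gives the adjoint.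
\<close>

section \<open>Conjugation of scalars\<close>

lemma conjugate_0 [simp]: "conjugate (0::'k::real_or_complex) = 0"
  using conjugate_scaleR[of 0 "0::'k"] by simp

lemma conjugate_of_real [simp]: "conjugate (of_real r :: 'k::real_or_complex) = of_real r"
proof -
  have "conjugate (1::'k) = 1"
    using mult_conjugate[of "1::'k"] by simp
  then show ?thesis
    using conjugate_scaleR[of r "1::'k"] by (simp add: of_real_def)
qed

section \<open>Inner product geometry\<close>

context hilbert_space
begin

lemma ip_add_right: "ip x (y + z) = ip x y + ip x z"
  by (metis ip_conjugate ip_add_left conjugate_add)

lemma ip_smul_right: "ip x (smul c y) = conjugate c * ip x y"
  by (metis ip_conjugate ip_smul_left conjugate_mult)

lemma ip_scaleR_left: "ip (r *\<^sub>R x) y = of_real r * ip x y"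
  by (metis ip_smul_left smul_of_real)

lemma ip_scaleR_right: "ip x (r *\<^sub>R y) = of_real r * ip x y"
  by (metis ip_smul_right smul_of_real conjugate_of_real)

lemma ip_minus_left: "ip (- x) y = - ip x y"
  using ip_scaleR_left[of "- 1" x y] by simp

lemma ip_minus_right: "ip x (- y) = - ip x y"
  using ip_scaleR_right[of x "- 1" y] by simp

lemma ip_diff_left: "ip (x - y) z = ip x z - ip y z"
  using ip_add_left[of x "- y" z] by (simp add: ip_minus_left)

lemma ip_diff_right: "ip x (y - z) = ip x y - ip x z"
  using ip_add_right[of x y "- z"] by (simp add: ip_minus_right)

lemma ip_zero_left [simp]: "ip 0 x = 0"
  using ip_scaleR_left[of 0 0 x] by simp

lemma ip_zero_right [simp]: "ip x 0 = 0"
  using ip_scaleR_right[of x 0 0] by simp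

lemma ip_eq_0_commute: "ip x y = 0 \<longleftrightarrow> ip y x = 0"
  by (metis ip_conjugate conjugate_0)

lemma ip_self_eq_0 [simp]: "ip x x = 0 \<longleftrightarrow> x = 0"
  by (simp add: ip_self)

lemma norm_ip_self: "norm (ip x x) = (norm x)\<^sup>2"
  by (simp add: ip_self norm_power)

lemma ip_right_cong_imp_eq:
  assumes "\<And>x. ip x y = ip x z"
  shows "y = z"
  using assms[of "y - z"] by (metis ip_diff_right ip_self_eq_0 right_minus_eq)

lemma norm_smul: "norm (smul c x) = norm c * norm x"
proof -
  have "of_real ((norm (smul c x))\<^sup>2) = (c * conjugate c) * ip x x"
    by (simp add: ip_self[symmetric] ip_smul_left ip_smul_right del: of_real_power)
  also have "\<dots> = of_real ((norm c * norm x)\<^sup>2)"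
    by (simp add: mult_conjugate ip_self power_mult_distrib scaleR_conv_of_real)
  finally have "(norm (smul c x))\<^sup>2 = (norm c * norm x)\<^sup>2"
    by (simp only: of_real_eq_iff)
  then show ?thesis
    by (simp add: power2_eq_iff_nonneg)
qed

lemma parallelogram_law:
  fixes x y :: 'h
  shows "(norm (x + y))\<^sup>2 + (norm (x - y))\<^sup>2 = 2 * (norm x)\<^sup>2 + 2 * (norm y)\<^sup>2"
proof -
  have "ip (x + y) (x + y) + ip (x - y) (x - y) = 2 * ip x x + 2 * ip y y"
    by (simp add: ip_add_left ip_add_right ip_diff_left ip_diff_right)
  then have "of_real ((norm (x + y))\<^sup>2 + (norm (x - y))\<^sup>2)
      = (of_real (2 * (norm x)\<^sup>2 + 2 * (norm y)\<^sup>2) :: 'k)"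
    by (simp add: ip_self)
  then show ?thesis
    by (simp only: of_real_eq_iff)
qed

lemma pythagoras:
  assumes "ip x y = 0"
  shows "(norm (x + y))\<^sup>2 = (norm x)\<^sup>2 + (norm y)\<^sup>2"
proof -
  have "ip (x + y) (x + y) = ip x x + ip y y"
    using assms ip_eq_0_commute[of x y] by (simp add: ip_add_left ip_add_right)
  then have "of_real ((norm (x + y))\<^sup>2) = (of_real ((norm x)\<^sup>2 + (norm y)\<^sup>2) :: 'k)"
    by (simp add: ip_self)
  then show ?thesis
    by (simp only: of_real_eq_iff)
qed

text \<open>Subtracting from \<open>x\<close> its component along \<open>y\<close> shortens it by an amount controlled by the inner
  product. Nonnegativity of the left-hand side is the Cauchy-Schwarz inequality; the same formula
  shows that a nearest point in a subspace must leave an orthogonal remainder.\<close>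

lemma norm_diff_projection_on_line:
  assumes "y \<noteq> 0"
  shows "(norm (x - smul (ip x y / of_real ((norm y)\<^sup>2)) y))\<^sup>2
    = (norm x)\<^sup>2 - (norm (ip x y) / norm y)\<^sup>2"
proof -
  define c where "c = ip x y / of_real ((norm y)\<^sup>2)"
  have "ip (x - smul c y) y = 0"
    using assms by (simp add: c_def ip_diff_left ip_smul_left ip_self)
  then have "ip (x - smul c y) (smul c y) = 0"
    by (simp add: ip_smul_right)
  from pythagoras[OF this] have "(norm x)\<^sup>2 = (norm (x - smul c y))\<^sup>2 + (norm c * norm y)\<^sup>2"
    by (simp add: norm_smul)
  moreover have "norm c * norm y = norm (ip x y) / norm y"
    using assms by (simp add: c_def norm_divide norm_mult power2_eq_square)
  ultimately show ?thesis
    by (simp add: c_def)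
qed

lemma cauchy_schwarz: "norm (ip x y) \<le> norm x * norm y"
proof (cases "y = 0")
  case False
  have "(norm (ip x y) / norm y)\<^sup>2 \<le> (norm x)\<^sup>2"
    using norm_diff_projection_on_line[OF False, of x]
      zero_le_power2[of "norm (x - smul (ip x y / of_real ((norm y)\<^sup>2)) y)"] by linarith
  then have "norm (ip x y) / norm y \<le> norm x"
    by (rule power2_le_imp_le) simp
  then show ?thesis
    using False by (simp add: divide_le_eq)
qed simp

lemma bounded_linear_ip_right: "bounded_linear (\<lambda>y. ip x y)"
  by (rule bounded_linear_intro[of _ "norm x"])
    (auto simp: ip_add_right ip_scaleR_right scaleR_conv_of_real
      cauchy_schwarz[THEN order_trans] mult.commute)

section \<open>Orthogonal projections\<close>

lemma closed_subspace_closed: "closed_subspace smul V \<Longrightarrow> closed V"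
  by (simp add: closed_subspace_def)

lemma closed_subspace_zero: "closed_subspace smul V \<Longrightarrow> 0 \<in> V"
  by (simp add: closed_subspace_def subspace_0)

lemma closed_subspace_add: "closed_subspace smul V \<Longrightarrow> x \<in> V \<Longrightarrow> y \<in> V \<Longrightarrow> x + y \<in> V"
  by (simp add: closed_subspace_def subspace_add)

lemma closed_subspace_diff: "closed_subspace smul V \<Longrightarrow> x \<in> V \<Longrightarrow> y \<in> V \<Longrightarrow> x - y \<in> V"
  by (simp add: closed_subspace_def subspace_diff)

lemma closed_subspace_smul: "closed_subspace smul V \<Longrightarrow> x \<in> V \<Longrightarrow> smul c x \<in> V"
  by (simp add: closed_subspace_def subspace_scale)

lemma closed_subspace_scaleR: "closed_subspace smul V \<Longrightarrow> x \<in> V \<Longrightarrow> r *\<^sub>R x \<in> V"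
  by (metis closed_subspace_smul smul_of_real)

text \<open>By the parallelogram law, two points of \<open>V\<close> almost nearest to \<open>x\<close> are close to each
  other, since their midpoint also lies in \<open>V\<close> and is no nearer than the distance. So a minimising
  sequence is Cauchy.\<close>

lemma nearest_point_exists:
  assumes V: "closed_subspace smul V"
  shows "\<exists>p\<in>V. \<forall>v\<in>V. norm (x - p) \<le> norm (x - v)"
proof -
  have ne: "V \<noteq> {}"
    using closed_subspace_zero[OF V] by auto
  define d where "d = infdist x V"
  have d_le: "d \<le> norm (x - v)" if "v \<in> V" for v
    using infdist_le[OF that, of x] by (simp add: d_def dist_norm)
  have d_nonneg: "0 \<le> d"
    by (simp add: d_def infdist_nonneg)
  have "\<exists>v\<in>V. norm (x - v) < d + 1 / real (Suc n)" for n
  proof -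
    have "bdd_below (dist x ` V)"
      by (rule bdd_belowI2[of _ 0]) simp
    moreover have "(INF v\<in>V. dist x v) < d + 1 / real (Suc n)"
      using ne by (simp add: d_def infdist_def)
    ultimately show ?thesis
      using ne by (simp add: cINF_less_iff dist_norm)
  qed
  then obtain v where v: "\<And>n. v n \<in> V" "\<And>n. norm (x - v n) < d + 1 / real (Suc n)"
    by metis
  (* The excess of the n-th squared distance bound over the minimum; it controls the Cauchy property. *)
  define a where "a n = (d + 1 / real (Suc n))\<^sup>2 - d\<^sup>2" for n
  have "a \<longlonglongrightarrow> (d + 0)\<^sup>2 - d\<^sup>2"
    unfolding a_def by (intro tendsto_intros LIMSEQ_Suc lim_1_over_n)
  then have a: "a \<longlonglongrightarrow> 0"
    by simp
  have close: "(norm (v m - v n))\<^sup>2 \<le> 2 * a m + 2 * a n" for m n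
  proof -
    have "(1/2) *\<^sub>R (v m + v n) \<in> V"
      by (intro closed_subspace_scaleR[OF V] closed_subspace_add[OF V] v)
    from d_le[OF this] have "d \<le> norm ((1/2) *\<^sub>R ((x - v m) + (x - v n)))"
      by (simp add: algebra_simps flip: scaleR_add_left)
    then have "(2 * d)\<^sup>2 \<le> (norm ((x - v m) + (x - v n)))\<^sup>2"
      using d_nonneg by (intro power_mono) auto
    moreover have "(norm (x - v k))\<^sup>2 \<le> (d + 1 / real (Suc k))\<^sup>2" for k
      using v(2)[of k] by (intro power_mono) auto
    from this[of m] this[of n] have "(norm (x - v m))\<^sup>2 + (norm (x - v n))\<^sup>2 \<le> a m + a n + 2 * d\<^sup>2"
      by (simp add: a_def)
    moreover have "norm ((x - v m) - (x - v n)) = norm (v m - v n)"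
      by (simp add: norm_minus_commute)
    ultimately show ?thesis
      using parallelogram_law[of "x - v m" "x - v n"] by (simp add: power_mult_distrib)
  qed
  have "Cauchy v"
  proof (rule metric_CauchyI)
    fix e :: real
    assume "0 < e"
    then have "eventually (\<lambda>n. a n < e\<^sup>2 / 4) sequentially"
      by (intro order_tendstoD(2)[OF a]) simp
    then obtain N where N: "\<And>n. n \<ge> N \<Longrightarrow> a n < e\<^sup>2 / 4"
      by (auto simp: eventually_sequentially)
    have "dist (v m) (v n) < e" if "m \<ge> N" "n \<ge> N" for m n
    proof -
      have "(norm (v m - v n))\<^sup>2 < e\<^sup>2"
        using close[of m n] N[OF that(1)] N[OF that(2)] by linarith
      then show ?thesis
        using \<open>0 < e\<close> by (simp add: dist_norm power2_less_imp_less)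
    qed
    then show "\<exists>N. \<forall>m\<ge>N. \<forall>n\<ge>N. dist (v m) (v n) < e"
      by blast
  qed
  then obtain p where p: "v \<longlonglongrightarrow> p"
    by (auto simp: Cauchy_convergent_iff convergent_def)
  have "p \<in> V"
    using closed_sequentially[OF closed_subspace_closed[OF V] _ p] v(1) by blast
  moreover have "norm (x - p) \<le> d + 0"
  proof (rule LIMSEQ_le)
    show "(\<lambda>n. norm (x - v n)) \<longlonglongrightarrow> norm (x - p)"
      by (intro tendsto_intros p)
    show "(\<lambda>n. d + 1 / real (Suc n)) \<longlonglongrightarrow> d + 0"
      by (intro tendsto_intros LIMSEQ_Suc lim_1_over_n)
    show "\<exists>N. \<forall>n\<ge>N. norm (x - v n) \<le> d + 1 / real (Suc n)"
      using v(2) less_imp_le by blast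
  qed
  ultimately show ?thesis
    using d_le by force
qed

text \<open>If the remainder \<open>x - p\<close> at a nearest point had a component along some \<open>v\<close> in \<open>V\<close>, moving
  \<open>p\<close> by that component would bring it nearer to \<open>x\<close>.\<close>

lemma orth_proj_exists:
  assumes V: "closed_subspace smul V"
  shows "\<exists>p\<in>V. \<forall>v\<in>V. ip (x - p) v = 0"
proof -
  obtain p where p: "p \<in> V" "\<And>v. v \<in> V \<Longrightarrow> norm (x - p) \<le> norm (x - v)"
    using nearest_point_exists[OF V] by blast
  have "ip (x - p) v = 0" if v: "v \<in> V" for v
  proof (cases "v = 0")
    case False
    define c where "c = ip (x - p) v / of_real ((norm v)\<^sup>2)"
    have "p + smul c v \<in> V"
      by (intro closed_subspace_add[OF V] closed_subspace_smul[OF V] p v)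
    then have "(norm (x - p))\<^sup>2 \<le> (norm (x - p - smul c v))\<^sup>2"
      using p(2)[of "p + smul c v"] by (intro power_mono) (auto simp: diff_diff_eq)
    then have "(norm (ip (x - p) v) / norm v)\<^sup>2 \<le> 0"
      using norm_diff_projection_on_line[OF False, of "x - p"] unfolding c_def by linarith
    then show ?thesis
      using False by simp
  qed simp
  then show ?thesis
    using p(1) by blast
qed

text \<open>Two candidates for the projection differ by a vector of \<open>V\<close> orthogonal to \<open>V\<close>, so the
  description defining \<open>orth_proj\<close> has a unique solution.\<close>

lemma orth_proj_properties:
  assumes V: "closed_subspace smul V"
  shows "orth_proj ip V x \<in> V \<and> (\<forall>v\<in>V. ip (x - orth_proj ip V x) v = 0)"
proof -
  have "q = p" if "p \<in> V" "q \<in> V" "\<forall>v\<in>V. ip (x - p) v = 0" "\<forall>v\<in>V. ip (x - q) v = 0" for p q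
  proof -
    have "q - p \<in> V"
      using closed_subspace_diff[OF V] that by blast
    then have "ip (x - p) (q - p) - ip (x - q) (q - p) = 0"
      using that by simp
    then have "ip (q - p) (q - p) = 0"
      by (simp flip: ip_diff_left)
    then show ?thesis
      by simp
  qed
  then have "\<exists>!p. p \<in> V \<and> (\<forall>v\<in>V. ip (x - p) v = 0)"
    using orth_proj_exists[OF V, of x] by blast
  then show ?thesis
    unfolding orth_proj_def by (rule theI')
qed

lemma orth_proj_mem: "closed_subspace smul V \<Longrightarrow> orth_proj ip V x \<in> V"
  using orth_proj_properties by blast

lemma ip_orth_proj_left:
  "closed_subspace smul V \<Longrightarrow> v \<in> V \<Longrightarrow> ip (orth_proj ip V x) v = ip x v"
  using orth_proj_properties[of V x] by (simp add: ip_diff_left)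

lemma ip_orth_proj_right:
  "closed_subspace smul V \<Longrightarrow> v \<in> V \<Longrightarrow> ip v (orth_proj ip V x) = ip v x"
  by (metis ip_orth_proj_left ip_conjugate)

section \<open>The adjoint of a bounded operator\<close>

text \<open>Let \<open>u\<close> be the part of \<open>x0\<close> orthogonal to the kernel of \<open>\<phi>\<close>, where \<open>\<phi> x0\<close> is not
  zero. The vector \<open>\<phi> x u - \<phi> u x\<close> lies in the kernel, so it is orthogonal to \<open>u\<close>,
  and this equation expresses \<open>\<phi> x\<close> through the inner product of \<open>x\<close> and \<open>u\<close>.\<close>

lemma riesz_representation:
  assumes add: "\<And>x y. \<phi> (x + y) = \<phi> x + \<phi> y"
    and smul: "\<And>c x. \<phi> (smul c x) = c * \<phi> x"
    and bounded: "\<And>x. norm (\<phi> x) \<le> C * norm x"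
  shows "\<exists>z. \<forall>x. \<phi> x = ip x z"
proof (cases "\<forall>x. \<phi> x = 0")
  case True
  then show ?thesis
    by (intro exI[of _ 0]) simp
next
  case False
  then obtain x0 where x0: "\<phi> x0 \<noteq> 0"
    by blast
  have scaleR: "\<phi> (r *\<^sub>R x) = r *\<^sub>R \<phi> x" for r x
    using smul[of "of_real r" x] by (simp add: smul_of_real scaleR_conv_of_real)
  have "bounded_linear \<phi>"
    by (rule bounded_linear_intro[of _ C]) (auto simp: add scaleR bounded mult.commute)
  then interpret \<phi>: bounded_linear \<phi> .
  define N where "N = {x. \<phi> x = 0}"
  have "closed N"
    unfolding N_def by (intro closed_Collect_eq continuous_on_const \<phi>.continuous_on continuous_on_id)
  then have N: "closed_subspace smul N"
    by (auto simp: closed_subspace_def subspace_def N_def add smul \<phi>.zero)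
  define u where "u = x0 - orth_proj ip N x0"
  have u_orth: "ip x u = 0" if "x \<in> N" for x
    using orth_proj_properties[OF N, of x0] that ip_eq_0_commute by (auto simp: u_def)
  have "\<phi> u = \<phi> x0"
    using orth_proj_mem[OF N, of x0] by (simp add: u_def \<phi>.diff N_def)
  then have "u \<noteq> 0"
    using x0 \<phi>.zero by auto
  define k where "k = conjugate (\<phi> u) / of_real ((norm u)\<^sup>2)"
  have k: "conjugate k = \<phi> u / of_real ((norm u)\<^sup>2)"
    using conjugate_mult[of "conjugate (\<phi> u)" "of_real (1 / (norm u)\<^sup>2)"]
    by (simp add: k_def conjugate_conjugate del: conjugate_of_real)
      (simp add: conjugate_of_real[of "1 / (norm u)\<^sup>2", simplified])
  have "\<phi> x = ip x (smul k u)" for x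
  proof -
    have "smul (\<phi> x) u - smul (\<phi> u) x \<in> N"
      by (simp add: N_def \<phi>.diff smul)
    then have "\<phi> x * of_real ((norm u)\<^sup>2) = \<phi> u * ip x u"
      using u_orth by (fastforce simp: ip_diff_left ip_smul_left ip_self)
    then show ?thesis
      using \<open>u \<noteq> 0\<close> by (simp add: k ip_smul_right field_simps del: of_real_power)
  qed
  then show ?thesis
    by blast
qed

lemma bounded_operator_bounded_linear:
  assumes "bounded_operator smul T"
  shows "bounded_linear T"
proof -
  interpret T: Vector_Spaces.linear smul smul T
    using assms by (simp add: bounded_operator_def)
  obtain C where "\<And>x. norm (T x) \<le> C * norm x"
    using assms by (auto simp: bounded_operator_def)
  then show ?thesis
    by (intro bounded_linear_intro[of _ C])
      (auto simp: T.add mult.commute T.scale simp flip: smul_of_real)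
qed

text \<open>The Riesz representation provides the adjoint pointwise, and nondegeneracy of the inner product makes
  it unique, so the description in \<open>hilbert_adjoint\<close> is satisfied.\<close>

lemma ip_hilbert_adjoint:
  assumes "bounded_operator smul T"
  shows "ip x (hilbert_adjoint ip T y) = ip (T x) y"
proof -
  interpret T: Vector_Spaces.linear smul smul T
    using assms by (simp add: bounded_operator_def)
  obtain C where C: "\<And>x. norm (T x) \<le> C * norm x"
    using assms by (auto simp: bounded_operator_def)
  have "\<exists>z. \<forall>x. ip (T x) y = ip x z" for y
  proof (rule riesz_representation)
    show "norm (ip (T x) y) \<le> (C * norm y) * norm x" for x
      using cauchy_schwarz[of "T x" y] mult_right_mono[OF C[of x], of "norm y"]
      by (simp add: algebra_simps)
  qed (simp_all add: T.add T.scale ip_add_left ip_smul_left)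
  then obtain S where S: "\<forall>x y. ip (T x) y = ip x (S y)"
    by metis
  moreover have "S' = S" if "\<forall>x y. ip (T x) y = ip x (S' y)" for S'
    using that S by (intro ext ip_right_cong_imp_eq) metis
  ultimately have "\<forall>x y. ip (T x) y = ip x (hilbert_adjoint ip T y)"
    unfolding hilbert_adjoint_def by (rule theI)
  then show ?thesis
    by simp
qed

lemma ip_hilbert_adjoint_left:
  assumes "bounded_operator smul T"
  shows "ip (hilbert_adjoint ip T y) x = ip y (T x)"
  by (metis ip_hilbert_adjoint[OF assms] ip_conjugate)

lemma norm_hilbert_adjoint_le:
  assumes T: "bounded_operator smul T" and C: "\<And>x. norm (T x) \<le> C * norm x"
  shows "norm (hilbert_adjoint ip T y) \<le> C * norm y"
proof -
  define z where "z = hilbert_adjoint ip T y"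
  have "(norm z)\<^sup>2 = norm (ip (T z) y)"
    by (simp add: z_def flip: norm_ip_self ip_hilbert_adjoint[OF T])
  also have "\<dots> \<le> (C * norm z) * norm y"
    using cauchy_schwarz[of "T z" y] mult_right_mono[OF C[of z], of "norm y"] by simp
  finally have "norm z * norm z \<le> norm z * (C * norm y)"
    by (simp add: power2_eq_square algebra_simps)
  moreover have "0 \<le> C * norm y"
    using order_trans[OF norm_ge_zero C] .
  ultimately show ?thesis
    by (cases "z = 0") (auto simp flip: z_def)
qed

section \<open>Uniform boundedness and operators with closed range\<close>

text \<open>The uniform boundedness principle. The closed sets \<open>F n\<close>, on which the functionals given by \<open>S\<close>
  are bounded by \<open>n\<close>, cover the space, so by Baire one of them contains a ball. Differences of points
  of that ball reach every direction, in particular the direction of each \<open>y\<close> in \<open>S\<close>.\<close>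

lemma weakly_bounded_imp_bounded:
  assumes weak: "\<And>z. \<exists>c. \<forall>y\<in>S. norm (ip y z) \<le> c"
  shows "\<exists>M>0. \<forall>y\<in>S. norm y \<le> M"
proof -
  define F where "F n = {z. \<forall>y\<in>S. norm (ip y z) \<le> real n}" for n :: nat
  have "F n = (\<Inter>y\<in>S. {z. norm (ip y z) \<le> real n})" for n
    by (auto simp: F_def)
  then have closed: "closed (F n)" for n
    by (auto intro!: closed_INT closed_Collect_le continuous_on_norm continuous_on_const continuous_on_id
      bounded_linear.continuous_on[OF bounded_linear_ip_right])
  have cover: "\<Union> (range F) = UNIV"
  proof -
    have "\<exists>n. z \<in> F n" for z
    proof -
      obtain c where "\<forall>y\<in>S. norm (ip y z) \<le> c"
        using weak by blast
      moreover obtain n where "c \<le> real n"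
        using real_arch_simple by blast
      ultimately have "z \<in> F n"
        by (auto simp: F_def intro: order_trans)
      then show ?thesis
        by blast
    qed
    then show ?thesis
      by blast
  qed
  have "\<exists>n. interior (F n) \<noteq> {}"
  proof (rule ccontr)
    assume "\<nexists>n. interior (F n) \<noteq> {}"
    then have "euclidean interior_of \<Union> (range F) = {}"
      using closed by (intro Baire_category_alt) (auto simp: completely_metrizable_space_euclidean)
    then show False
      by (simp add: cover)
  qed
  then obtain n z0 where "z0 \<in> interior (F n)"
    by blast
  then obtain r where r: "0 < r" "cball z0 r \<subseteq> F n"
    by (auto simp: mem_interior_cball)
  have "norm y \<le> 2 * real n / r" if "y \<in> S" for y
  proof (cases "y = 0")
    case False
    define u where "u = (r / norm y) *\<^sub>R y"
    have "norm u = r"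
      using False r by (simp add: u_def)
    then have "z0 \<in> F n" "z0 + u \<in> F n"
      using r by (auto simp: subset_eq dist_norm)
    then have "norm (ip y (z0 + u)) \<le> n" "norm (ip y z0) \<le> n"
      using that by (auto simp: F_def)
    then have "norm (ip y u) \<le> 2 * real n"
      using norm_triangle_ineq4[of "ip y (z0 + u)" "ip y z0"] by (simp add: ip_add_right)
    moreover have "norm (ip y u) = r * norm y"
      using False r
      by (simp add: u_def ip_scaleR_right norm_mult norm_divide norm_ip_self power2_eq_square)
    ultimately show ?thesis
      using r by (simp add: field_simps)
  qed (use r in simp)
  moreover have "2 * real n / r \<le> 2 * real n / r + 1" "0 < 2 * real n / r + 1"
    using r by (auto intro: add_nonneg_pos)
  ultimately show ?thesis
    by (meson order_trans)
qed

text \<open>A dual form of the open mapping theorem. Dividing each \<open>y\<close> in the range of \<open>K\<close> by the norm of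
  its image under the adjoint gives a weakly bounded set: only the projection \<open>K x\<close> of a test vector
  to the range matters, and the inner product of \<open>y\<close> with \<open>K x\<close> is that of the image of \<open>y\<close> with
  \<open>x\<close>. Closedness of the range is what makes this projection available. Hence the adjoint is
  bounded below on the range of \<open>K\<close>. Every \<open>w\<close> in the range of the adjoint is the image of some
  \<open>h\<close> in the range of \<open>K\<close>, and the square of \<open>norm w\<close> is the inner product of \<open>K w\<close>
  with \<open>h\<close>, which transfers the bound to \<open>K\<close>.\<close>

lemma bounded_below_on_range_adjoint:
  assumes K: "bounded_operator smul K" and closed: "closed (range K)"
  shows "\<exists>c>0. \<forall>w\<in>range (hilbert_adjoint ip K). c * norm w \<le> norm (K w)"
proof -
  interpret K: Vector_Spaces.linear smul smul K
    using K by (simp add: bounded_operator_def)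
  let ?A = "hilbert_adjoint ip K" and ?R = "range K"
  have R: "closed_subspace smul ?R"
    using closed K.subspace_image[OF subspace_UNIV] by (simp add: closed_subspace_def)
  have "\<exists>c. \<forall>y\<in>(\<lambda>y. y /\<^sub>R norm (?A y)) ` ?R. norm (ip y z) \<le> c" for z
  proof -
    obtain x where x: "orth_proj ip ?R z = K x"
      using orth_proj_mem[OF R, of z] by blast
    have "norm (ip (y /\<^sub>R norm (?A y)) z) \<le> norm x" if "y \<in> ?R" for y
    proof -
      have "ip y z = ip (?A y) x"
        using ip_orth_proj_right[OF R that, of z] by (simp add: x ip_hilbert_adjoint_left[OF K])
      then have "norm (ip y z) \<le> norm (?A y) * norm x"
        by (simp add: cauchy_schwarz)
      then show ?thesis
        by (cases "?A y = 0") (simp_all add: ip_scaleR_left norm_mult norm_inverse norm_divide field_simps)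
    qed
    then show ?thesis
      by blast
  qed
  from weakly_bounded_imp_bounded[OF this] obtain M where "0 < M"
    and M: "\<And>y. y \<in> ?R \<Longrightarrow> norm (y /\<^sub>R norm (?A y)) \<le> M"
    by blast
  (* If the adjoint kills y, division by zero hides y from M; then y is orthogonal to the range of K
     and lies in it. *)
  have below: "norm y \<le> M * norm (?A y)" if "y \<in> ?R" for y
  proof (cases "?A y = 0")
    case True
    obtain x where "y = K x"
      using \<open>y \<in> ?R\<close> by blast
    then have "ip y y = 0"
      using ip_hilbert_adjoint[OF K, of x y] True by simp
    then show ?thesis
      using \<open>0 < M\<close> by simp
  next
    case False
    then show ?thesis
      using M[OF that] by (simp add: field_simps)
  qed
  have "norm w \<le> M * norm (K w)" if "w \<in> range ?A" for w
  proof -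
    obtain g where w: "w = ?A g"
      using \<open>w \<in> range ?A\<close> by blast
    (* The adjoint vanishes on the complement of the range of K, so g may be replaced by its
       projection to that range, where the lower bound is known. *)
    define h where "h = orth_proj ip ?R g"
    have "h \<in> ?R"
      by (simp add: h_def orth_proj_mem[OF R])
    have w_h: "w = ?A h"
      by (rule ip_right_cong_imp_eq)
        (simp add: w h_def ip_hilbert_adjoint[OF K] ip_orth_proj_right[OF R])
    have "(norm w)\<^sup>2 = norm (ip (K w) h)"
      using norm_ip_self[of w] ip_hilbert_adjoint[OF K, of w h] w_h by simp
    also have "\<dots> \<le> norm (K w) * (M * norm w)"
      using cauchy_schwarz[of "K w" h] mult_left_mono[OF below[OF \<open>h \<in> ?R\<close>], of "norm (K w)"]
      by (simp add: w_h)
    finally have "norm w * norm w \<le> norm w * (M * norm (K w))"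
      by (simp add: power2_eq_square algebra_simps)
    then show ?thesis
      using \<open>0 < M\<close> by (cases "w = 0") auto
  qed
  then show ?thesis
    using \<open>0 < M\<close> by (intro exI[of _ "1 / M"]) (simp add: field_simps)
qed

section \<open>Projections onto image subspaces\<close>

text \<open>A lower bound pulls Cauchy sequences in \<open>K ` W\<close> back to Cauchy sequences in \<open>W\<close>.\<close>

lemma closed_subspace_image:
  assumes K: "bounded_operator smul K" and W: "closed_subspace smul W"
    and "0 < c" and c: "\<And>w. w \<in> W \<Longrightarrow> c * norm w \<le> norm (K w)"
  shows "closed_subspace smul (K ` W)"
proof -
  interpret K: Vector_Spaces.linear smul smul K
    using K by (simp add: bounded_operator_def)
  have "Real_Vector_Spaces.subspace W"
    using closed_subspace_zero[OF W] closed_subspace_add[OF W] closed_subspace_scaleR[OF W]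
    by (auto simp: real_vector.subspace_def)
  then have "complete (K ` W)"
    using \<open>0 < c\<close> c bounded_operator_bounded_linear[OF K] closed_subspace_closed[OF W]
    by (intro complete_isometric_image[of c]) (auto simp: complete_eq_closed)
  then show ?thesis
    using W K.subspace_image by (auto simp: closed_subspace_def complete_eq_closed)
qed

text \<open>With \<open>p\<close> and \<open>q\<close> the two projections, the square of \<open>norm p\<close> is the inner product of \<open>q\<close>
  with \<open>K p\<close>.\<close>

lemma norm_orth_proj_adjoint_le:
  assumes K: "bounded_operator smul K" and W: "closed_subspace smul W"
    and KW: "closed_subspace smul (K ` W)" and C: "\<And>x. norm (K x) \<le> C * norm x"
  shows "norm (orth_proj ip W (hilbert_adjoint ip K f)) \<le> C * norm (orth_proj ip (K ` W) f)"
proof -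
  define p where "p = orth_proj ip W (hilbert_adjoint ip K f)"
  define q where "q = orth_proj ip (K ` W) f"
  have "p \<in> W"
    by (simp add: p_def orth_proj_mem[OF W])
  have "ip p p = ip (hilbert_adjoint ip K f) p"
    using ip_orth_proj_left[OF W \<open>p \<in> W\<close>] by (simp add: p_def)
  also have "\<dots> = ip q (K p)"
    using \<open>p \<in> W\<close> by (simp add: q_def ip_hilbert_adjoint_left[OF K] ip_orth_proj_left[OF KW])
  finally have "(norm p)\<^sup>2 = norm (ip q (K p))"
    by (metis norm_ip_self)
  also have "\<dots> \<le> norm q * (C * norm p)"
    using cauchy_schwarz[of q "K p"] mult_left_mono[OF C[of p], of "norm q"] by simp
  finally have "norm p * norm p \<le> norm p * (C * norm q)"
    by (simp add: power2_eq_square algebra_simps)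
  moreover have "0 \<le> C * norm q"
    using order_trans[OF norm_ge_zero C] .
  ultimately show ?thesis
    by (cases "p = 0") (auto simp flip: p_def q_def)
qed

text \<open>With \<open>p\<close> and \<open>q\<close> the two projections and \<open>q = K w\<close>, the square of \<open>norm q\<close> is the inner
  product of \<open>p\<close> with \<open>w\<close>, and \<open>w\<close> is controlled by \<open>q\<close> through the lower bound.\<close>

lemma norm_orth_proj_image_le:
  assumes K: "bounded_operator smul K" and W: "closed_subspace smul W"
    and KW: "closed_subspace smul (K ` W)"
    and "0 < c" and c: "\<And>w. w \<in> W \<Longrightarrow> c * norm w \<le> norm (K w)"
  shows "c * norm (orth_proj ip (K ` W) f) \<le> norm (orth_proj ip W (hilbert_adjoint ip K f))"
proof -
  define p where "p = orth_proj ip W (hilbert_adjoint ip K f)"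
  define q where "q = orth_proj ip (K ` W) f"
  have "q \<in> K ` W"
    by (simp add: q_def orth_proj_mem[OF KW])
  then obtain w where w: "w \<in> W" "q = K w"
    by blast
  have "ip q q = ip f (K w)"
    using ip_orth_proj_left[OF KW \<open>q \<in> K ` W\<close>] by (simp add: q_def w(2)[symmetric, unfolded q_def])
  also have "\<dots> = ip p w"
    using w(1) by (simp add: p_def ip_hilbert_adjoint_left[OF K] ip_orth_proj_left[OF W])
  finally have "(norm q)\<^sup>2 \<le> norm p * norm w"
    by (metis norm_ip_self cauchy_schwarz)
  then have "c * (norm q)\<^sup>2 \<le> norm p * (c * norm w)"
    using mult_left_mono[of "(norm q)\<^sup>2" "norm p * norm w" c] \<open>0 < c\<close> by (simp add: algebra_simps)
  also have "\<dots> \<le> norm p * norm q"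
    using c[OF w(1)] by (simp add: w(2) mult_left_mono)
  finally have "norm q * (c * norm q) \<le> norm q * norm p"
    by (simp add: power2_eq_square algebra_simps)
  then show ?thesis
    by (cases "q = 0") (auto simp flip: p_def q_def)
qed

end

section \<open>Images of fusion frames\<close>

theorem theorem2p6:
  fixes smul :: "'k::real_or_complex \<Rightarrow> 'h::banach \<Rightarrow> 'h"
    and ip :: "'h \<Rightarrow> 'h \<Rightarrow> 'k"
    and K :: "'h \<Rightarrow> 'h"
    and I :: "'i set"
    and W :: "'i \<Rightarrow> 'h set"
    and \<omega> :: "'i \<Rightarrow> real"
  assumes "hilbert_space smul ip"
    and "separable_space (euclidean :: 'h topology)"
    and "bounded_operator smul K"
    and "closed (range K)"
    and "countable I"
    and "fusion_frame_for smul ip (range (hilbert_adjoint ip K)) I W \<omega>"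
  shows "K_fusion_frame smul ip K I (\<lambda>i. K ` W i) \<omega>"
proof -
  interpret hilbert_space smul ip
    by fact
  note K = assms(3)
  let ?A = "hilbert_adjoint ip K"
  have W: "closed_subspace smul (W i)" "W i \<subseteq> range ?A" "0 < \<omega> i" if "i \<in> I" for i
    using assms(6) that by (auto simp: fusion_frame_for_def)
  define s where "s f i = (\<omega> i)\<^sup>2 * (norm (orth_proj ip (W i) (?A f)))\<^sup>2" for f i
  define t where "t f i = (\<omega> i)\<^sup>2 * (norm (orth_proj ip (K ` W i) f))\<^sup>2" for f i
  obtain A B where AB: "0 < A" "A \<le> B"
    and summable_s: "\<And>f. s f summable_on I"
    and lower_s: "\<And>f. A * (norm (?A f))\<^sup>2 \<le> infsum (s f) I"
    and upper_s: "\<And>f. infsum (s f) I \<le> B * (norm (?A f))\<^sup>2"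
    using assms(6) unfolding fusion_frame_for_def s_def by blast
  obtain c where c: "0 < c" "\<And>w. w \<in> range ?A \<Longrightarrow> c * norm w \<le> norm (K w)"
    using bounded_below_on_range_adjoint[OF K assms(4)] by blast
  obtain C where C: "0 < C" "\<And>x. norm (K x) \<le> C * norm x"
    using bounded_linear.pos_bounded[OF bounded_operator_bounded_linear[OF K]]
    by (auto simp: mult.commute)
  have KW: "closed_subspace smul (K ` W i)" if "i \<in> I" for i
    using W[OF that] c by (intro closed_subspace_image[OF K, of _ c]) auto
  have s_le: "s f i \<le> C\<^sup>2 * t f i" if "i \<in> I" for f i
  proof -
    have "(norm (orth_proj ip (W i) (?A f)))\<^sup>2 \<le> (C * norm (orth_proj ip (K ` W i) f))\<^sup>2"
      using norm_orth_proj_adjoint_le[OF K W(1) KW C(2)] that by (intro power_mono) auto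
    from mult_left_mono[OF this, of "(\<omega> i)\<^sup>2"] show ?thesis
      by (simp add: s_def t_def power_mult_distrib algebra_simps)
  qed
  have t_le: "t f i \<le> (1 / c\<^sup>2) * s f i" if "i \<in> I" for f i
  proof -
    have "c * norm (orth_proj ip (K ` W i) f) \<le> norm (orth_proj ip (W i) (?A f))"
      using W[OF that] c by (intro norm_orth_proj_image_le[OF K _ KW[OF that]]) auto
    then have "(c * norm (orth_proj ip (K ` W i) f))\<^sup>2 \<le> (norm (orth_proj ip (W i) (?A f)))\<^sup>2"
      using c(1) by (intro power_mono) auto
    from mult_left_mono[OF this, of "(\<omega> i)\<^sup>2"] show ?thesis
      using c(1) by (simp add: s_def t_def power_mult_distrib field_simps)
  qed
  have summable_t: "t f summable_on I" for f
  proof (rule summable_on_comparison_test)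
    show "(\<lambda>i. (1 / c\<^sup>2) * s f i) summable_on I"
      by (intro summable_on_cmult_right summable_s)
    show "t f i \<le> (1 / c\<^sup>2) * s f i" if "i \<in> I" for i
      using that by (rule t_le)
    show "0 \<le> t f i" for i
      by (simp add: t_def)
  qed
  have lower_t: "A / C\<^sup>2 * (norm (?A f))\<^sup>2 \<le> infsum (t f) I" for f
  proof -
    have "A * (norm (?A f))\<^sup>2 \<le> infsum (\<lambda>i. C\<^sup>2 * t f i) I"
      by (rule order_trans[OF lower_s])
        (intro infsum_mono summable_s summable_on_cmult_right summable_t s_le)
    also have "\<dots> = C\<^sup>2 * infsum (t f) I"
      by (rule infsum_cmult_right')
    finally show ?thesis
      using C(1) by (simp add: field_simps)
  qed
  have upper_t: "infsum (t f) I \<le> B * C\<^sup>2 / c\<^sup>2 * (norm f)\<^sup>2" for f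
  proof -
    have "infsum (t f) I \<le> infsum (\<lambda>i. (1 / c\<^sup>2) * s f i) I"
      by (intro infsum_mono summable_s summable_on_cmult_right summable_t t_le)
    also have "\<dots> = (1 / c\<^sup>2) * infsum (s f) I"
      by (rule infsum_cmult_right')
    also have "\<dots> \<le> (1 / c\<^sup>2) * (B * (C * norm f)\<^sup>2)"
    proof (rule mult_left_mono)
      have "B * (norm (?A f))\<^sup>2 \<le> B * (C * norm f)\<^sup>2"
        using AB norm_hilbert_adjoint_le[OF K C(2), of f] by (intro mult_left_mono power_mono) auto
      then show "infsum (s f) I \<le> B * (C * norm f)\<^sup>2"
        using upper_s[of f] by linarith
    qed simp
    finally show ?thesis
      by (simp add: power_mult_distrib algebra_simps)
  qed
  show ?thesis
    unfolding K_fusion_frame_def t_def[symmetric]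
  proof (intro conjI ballI exI allI)
    show "0 < A / C\<^sup>2" "0 < B * C\<^sup>2 / c\<^sup>2"
      using AB c(1) C(1) by auto
  qed (use KW W(3) summable_t lower_t upper_t in auto)
qed

end
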